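(* Let $m,d,d_1,d_2,n$ be non-negative integers. There are the following isomorphisms: (1) $M_{m,d}^{L,\mathrm{fr}}\simeq M_{m+1,d}^L$ if $d$ divides $m$; (2) $M_{m,d}^{C,\mathrm{fr}}\simeq M_{m+1,d}^{C}$ if $d$ divides $m$; (3) $M_{m,d_1,d_2}^{F_0,\mathrm{fr}}\simeq M_{m+1,d_1,d_2}^{F_0}$ if $d_1+d_2$ divides $m$; (4) $M_{(1-n)d_1+d_2,\,d_1,\,d_2}^{F_n,\mathrm{fr}}\simeq M_{(1-n)d_1+d_2+1,\,d_1,\,d_2}^{F_n}$ if $n>0$ and $(1-n)d_1+d_2\geq 0$.
   Context: All representations are over $\mathbb{C}$. For a quiver $Q$ with finite vertex set $Q_0$ and arrow set $Q_1$, the Euler form on $\mathbb{Z}Q_0$ is $\langle \underline a,\underline b\rangle=\sum_{i\in Q_0}a_ib_i-\sum_{(\alpha:i\to j)\in Q_1}a_ib_j$, and the antisymmetrized Euler form is $\{\underline a,\underline b\}=\langle \underline a,\underline b\rangle-\langle \underline b,\underline a\rangle$. A stability condition is a linear form $\theta$ on $\mathbb{Z}Q_0$, with slope $\mu(\underline e)=\theta(\underline e)/|\underline e|$, $|\underline e|=\sum_i e_i$. A representation $V$ is $\theta$-semistable if $\mu(\underline{\dim}\,U)\le\mu(\underline{\dim}\,V)$ for all nonzero proper subrepresentations $U\subset V$. For a dimension vector $\underline d$, the moduli space $M^{\theta\text{-}sst}_{\underline d}(Q)$ of $\theta$-semistable representations is the GIT quotient $R_{\underline d}^{\theta\text{-}sst}/\!/G_{\underline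 d}$, where $R_{\underline d}^{\theta\text{-}sst}\subset\bigoplus_{\alpha:i\to j}\mathrm{Hom}(\mathbb{C}^{d_i},\mathbb{C}^{d_j})$ is the semistable locus and $G_{\underline d}=\prod_i GL_{d_i}(\mathbb{C})$ acts by base change. The quivers: - type $L$: vertices $i_1,\dots,i_m,j$, with exactly one arrow $i_k\to j$ for each $k$; - type $C$: vertices $i_1,\dots,i_m,j$, with exactly two arrows $i_k\to j$ for each $k$; - type $F_n$: vertices $i_1,\dots,i_m,j_1,j_2$, with exactly one arrow $i_k\to j_1$ and one arrow $i_k\to j_2$ for each $k$, and exactly $n$ arrows $j_1\to j_2$. $M^L_{m,d}$ (resp. $M^C_{m,d}$) is the moduli space of $\theta$-semistable representations of the type $L$ (resp. type $C$) quiver with dimension $1$ at every $i_k$ and dimension $d$ at $j$. $M^{F_n}_{m,d_1,d_2}$ is the moduli space of $\theta$-semistable representations of the type $F_n$ quiver with dimension $1$ at every $i_k$, $d_1$ at $j_1$ and $d_2$ at $j_2$. In each case $\theta(\cdot)=\{\underline d,\cdot\}$, where $\underline d$ is the full dimension vector of the moduli space in question. Framed moduli: given $Q$, $\underline d$, an integer-valued $\theta$ with $\theta(\underline d)=0$, and a framing vector $\underline n\in\mathbb{N}Q_0$, let $\widehat Q$ be obtained from $Q$ by adding a vertex $i_0$ and $n_i$ arrows $i_0\to i$ for each $i\in Q_0$; let $\underline{\hat d}$ extend $\underline d$ by the entry $1$ at $i_0$, and let $\hat\theta$ extend $\theta$ by the entry $1$ at $i_0$. The moduli space of $\theta$-semistable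 $\underline n$-framed representations is $M^{\hat\theta\text{-}sst}_{\underline{\hat d}}(\widehat Q)$ (replacing $\theta$ by a positive multiple that is still integer-valued does not change it). The spaces $M_{m,d}^{L,\mathrm{fr}}$, $M_{m,d}^{C,\mathrm{fr}}$, $M_{m,d_1,d_2}^{F_n,\mathrm{fr}}$ are the framed moduli spaces associated with the quivers, dimension vectors $\underline d$ and stabilities $\theta=\{\underline d,\cdot\}$ of $M_{m,d}^{L}$, $M_{m,d}^{C}$, $M_{m,d_1,d_2}^{F_n}$, with framing vector $\underline n=e_j$, $\underline n=2e_j$, $\underline n=e_{j_1}+e_{j_2}$ respectively ($e_i$ being the basis vector of vertex $i$). *)

theory Defs
  imports
    "HOL-Analysis.Abstract_Topology"
    "HOL-Algebra.Product_Groups"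
    "Graph_Theory.Digraph"
    "Jordan_Normal_Form.VS_Connect"
begin

section \<open>Spaces with functions\<close>

text \<open>
  A complex variety in the classical sense: a set of closed points with its Zariski topology and
  its sheaf of complex-valued regular functions. Membership of \<open>\<phi>\<close> in \<open>regular X U\<close> is only meant
  to depend on the restriction of \<open>\<phi>\<close> to \<open>U\<close>.
\<close>

record 'p function_space =
  zariski :: "'p topology"
  regular :: "'p set \<Rightarrow> ('p \<Rightarrow> complex) set"

text \<open>
  Isomorphism of varieties: a homeomorphism of the Zariski topologies that identifies
  the regular functions on every open set with those on its preimage.
\<close>

definition isomorphic_spaces :: "'p function_space \<Rightarrow> 'q function_space \<Rightarrow> bool" where
  "isomorphic_spaces X Y \<longleftrightarrow>
     (\<exists>f. homeomorphic_map (zariski X) (zariski Y) f \<and>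
          (\<forall>U \<phi>. openin (zariski Y) U \<longrightarrow>
             (\<phi> \<in> regular Y U \<longleftrightarrow> \<phi> \<circ> f \<in> regular X {x \<in> topspace (zariski X). f x \<in> U})))"

definition quotient_topology :: "'x topology \<Rightarrow> ('x \<Rightarrow> 'p) \<Rightarrow> 'p topology" where
  "quotient_topology T p =
     topology (\<lambda>U. U \<subseteq> p ` topspace T \<and> openin T {x \<in> topspace T. p x \<in> U})"

lemma openin_quotient_topology:
  "openin (quotient_topology T p) U \<longleftrightarrow>
     U \<subseteq> p ` topspace T \<and> openin T {x \<in> topspace T. p x \<in> U}"
proof -
  have *: "{x \<in> topspace T. p x \<in> U \<inter> V} =
      {x \<in> topspace T. p x \<in> U} \<inter> {x \<in> topspace T. p x \<in> V}" for U V
    by blast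
  have **: "{x \<in> topspace T. p x \<in> \<Union>K} = (\<Union>U\<in>K. {x \<in> topspace T. p x \<in> U})" for K
    by blast
  have "istopology (\<lambda>U. U \<subseteq> p ` topspace T \<and> openin T {x \<in> topspace T. p x \<in> U})"
    unfolding istopology_def * ** by (auto intro!: openin_Union)
  then show ?thesis
    by (simp add: quotient_topology_def)
qed


section \<open>Quivers, Euler form, stability\<close>

text \<open>
  A quiver is a \<open>pre_digraph\<close>. Elements of the lattice of dimension vectors are functions on the
  type of vertices of which only the values on \<open>verts Q\<close> matter; a stability condition is a linear
  form, given as a function on these.
\<close>

definition euler_form :: "('v, 'a) pre_digraph \<Rightarrow> ('v \<Rightarrow> int) \<Rightarrow> ('v \<Rightarrow> int) \<Rightarrow> int" where
  "euler_form Q a b = (\<Sum>i\<in>verts Q. a i * b i) - (\<Sum>\<alpha>\<in>arcs Q. a (tail Q \<alpha>) * b (head Q \<alpha>))"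

definition antisym_euler_form :: "('v, 'a) pre_digraph \<Rightarrow> ('v \<Rightarrow> int) \<Rightarrow> ('v \<Rightarrow> int) \<Rightarrow> int" where
  "antisym_euler_form Q a b = euler_form Q a b - euler_form Q b a"

definition slope :: "('v, 'a) pre_digraph \<Rightarrow> (('v \<Rightarrow> int) \<Rightarrow> int) \<Rightarrow> ('v \<Rightarrow> int) \<Rightarrow> rat" where
  "slope Q \<theta> e = of_int (\<theta> e) / of_int (\<Sum>i\<in>verts Q. e i)"


section \<open>Representations\<close>

type_synonym 'a rep = "'a \<Rightarrow> complex mat"

definition rep_space :: "('v, 'a) pre_digraph \<Rightarrow> ('v \<Rightarrow> nat) \<Rightarrow> 'a rep set" where
  "rep_space Q d = (\<Pi>\<^sub>E \<alpha>\<in>arcs Q. carrier_mat (d (head Q \<alpha>)) (d (tail Q \<alpha>)))"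

abbreviation coord_space :: "nat \<Rightarrow> (complex, complex vec) module" where
  "coord_space n \<equiv> module_vec TYPE(complex) n"

definition subspace_dim :: "nat \<Rightarrow> complex vec set \<Rightarrow> nat" where
  "subspace_dim n W = vectorspace.dim class_ring ((coord_space n)\<lparr>carrier := W\<rparr>)"

definition subrep ::
  "('v, 'a) pre_digraph \<Rightarrow> ('v \<Rightarrow> nat) \<Rightarrow> 'a rep \<Rightarrow> ('v \<Rightarrow> complex vec set) \<Rightarrow> bool" where
  "subrep Q d x U \<longleftrightarrow>
     (\<forall>i\<in>verts Q. VectorSpace.subspace class_ring (U i) (coord_space (d i))) \<and>
     (\<forall>\<alpha>\<in>arcs Q. \<forall>u\<in>U (tail Q \<alpha>). x \<alpha> *\<^sub>v u \<in> U (head Q \<alpha>))"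

definition semistable ::
  "('v, 'a) pre_digraph \<Rightarrow> (('v \<Rightarrow> int) \<Rightarrow> int) \<Rightarrow> ('v \<Rightarrow> nat) \<Rightarrow> 'a rep \<Rightarrow> bool" where
  "semistable Q \<theta> d x \<longleftrightarrow>
     (\<forall>U. subrep Q d x U \<and>
          (\<exists>i\<in>verts Q. U i \<noteq> {0\<^sub>v (d i)}) \<and>
          (\<exists>i\<in>verts Q. U i \<noteq> carrier_vec (d i)) \<longrightarrow>
          slope Q \<theta> (\<lambda>i. int (subspace_dim (d i) (U i))) \<le> slope Q \<theta> (\<lambda>i. int (d i)))"

definition semistable_locus ::
  "('v, 'a) pre_digraph \<Rightarrow> (('v \<Rightarrow> int) \<Rightarrow> int) \<Rightarrow> ('v \<Rightarrow> nat) \<Rightarrow> 'a rep set" where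
  "semistable_locus Q \<theta> d = {x \<in> rep_space Q d. semistable Q \<theta> d x}"


section \<open>The representation space as an affine variety\<close>

inductive_set poly_fun ::
  "('v, 'a) pre_digraph \<Rightarrow> ('v \<Rightarrow> nat) \<Rightarrow> ('a rep \<Rightarrow> complex) set"
  for Q :: "('v, 'a) pre_digraph" and d :: "'v \<Rightarrow> nat" where
  poly_const: "(\<lambda>x. c) \<in> poly_fun Q d"
| poly_coord: "\<lbrakk>\<alpha> \<in> arcs Q; r < d (head Q \<alpha>); s < d (tail Q \<alpha>)\<rbrakk> \<Longrightarrow>
    (\<lambda>x. x \<alpha> $$ (r, s)) \<in> poly_fun Q d"
| poly_add: "\<lbrakk>f \<in> poly_fun Q d; g \<in> poly_fun Q d\<rbrakk> \<Longrightarrow> (\<lambda>x. f x + g x) \<in> poly_fun Q d"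
| poly_mult: "\<lbrakk>f \<in> poly_fun Q d; g \<in> poly_fun Q d\<rbrakk> \<Longrightarrow> (\<lambda>x. f x * g x) \<in> poly_fun Q d"

text \<open>The Zariski topology, generated by the principal open sets.\<close>

definition rep_topology :: "('v, 'a) pre_digraph \<Rightarrow> ('v \<Rightarrow> nat) \<Rightarrow> 'a rep topology" where
  "rep_topology Q d =
     topology_generated_by {{x \<in> rep_space Q d. f x \<noteq> 0} | f. f \<in> poly_fun Q d}"

text \<open>Functions that are regular on a subset \<open>W\<close>: locally quotients of polynomials.\<close>

definition rep_regular ::
  "('v, 'a) pre_digraph \<Rightarrow> ('v \<Rightarrow> nat) \<Rightarrow> 'a rep set \<Rightarrow> ('a rep \<Rightarrow> complex) set" where
  "rep_regular Q d W =
     {\<phi>. \<forall>x\<in>W. \<exists>V. openin (subtopology (rep_topology Q d) W) V \<and> x \<in> V \<and>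
          (\<exists>f\<in>poly_fun Q d. \<exists>g\<in>poly_fun Q d. \<forall>y\<in>V. g y \<noteq> 0 \<and> \<phi> y = f y / g y)}"


section \<open>Base change and the GIT quotient\<close>

abbreviation GL :: "nat \<Rightarrow> complex mat monoid" where
  "GL n \<equiv> units_of (ring_mat TYPE(complex) n ())"

definition base_change_group :: "('v, 'a) pre_digraph \<Rightarrow> ('v \<Rightarrow> nat) \<Rightarrow> ('v \<Rightarrow> complex mat) monoid" where
  "base_change_group Q d = product_group (verts Q) (\<lambda>i. GL (d i))"

definition base_change ::
  "('v, 'a) pre_digraph \<Rightarrow> ('v \<Rightarrow> nat) \<Rightarrow> ('v \<Rightarrow> complex mat) \<Rightarrow> 'a rep \<Rightarrow> 'a rep" where
  "base_change Q d g x =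
     (\<lambda>\<alpha>\<in>arcs Q. g (head Q \<alpha>) * x \<alpha> * inv\<^bsub>GL (d (tail Q \<alpha>))\<^esub> g (tail Q \<alpha>))"

definition rep_orbit :: "('v, 'a) pre_digraph \<Rightarrow> ('v \<Rightarrow> nat) \<Rightarrow> 'a rep \<Rightarrow> 'a rep set" where
  "rep_orbit Q d x = (\<lambda>g. base_change Q d g x) ` carrier (base_change_group Q d)"

text \<open>
  The GIT quotient of the semistable locus is its good quotient by the base change group. Concretely:
  two semistable points are identified iff the closures of their orbits meet inside the semistable
  locus, a set is open iff its preimage is, and a function is regular iff its (automatically
  invariant) pullback is.
\<close>

definition semistable_topology ::
  "('v, 'a) pre_digraph \<Rightarrow> (('v \<Rightarrow> int) \<Rightarrow> int) \<Rightarrow> ('v \<Rightarrow> nat) \<Rightarrow> 'a rep topology" where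
  "semistable_topology Q \<theta> d = subtopology (rep_topology Q d) (semistable_locus Q \<theta> d)"

definition GIT_class ::
  "('v, 'a) pre_digraph \<Rightarrow> (('v \<Rightarrow> int) \<Rightarrow> int) \<Rightarrow> ('v \<Rightarrow> nat) \<Rightarrow> 'a rep \<Rightarrow> 'a rep set" where
  "GIT_class Q \<theta> d x =
     {y \<in> semistable_locus Q \<theta> d.
        (semistable_topology Q \<theta> d closure_of rep_orbit Q d x) \<inter>
        (semistable_topology Q \<theta> d closure_of rep_orbit Q d y) \<noteq> {}}"

definition moduli_space ::
  "('v, 'a) pre_digraph \<Rightarrow> (('v \<Rightarrow> int) \<Rightarrow> int) \<Rightarrow> ('v \<Rightarrow> nat) \<Rightarrow> 'a rep set function_space" where
  "moduli_space Q \<theta> d =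
     \<lparr>zariski = quotient_topology (semistable_topology Q \<theta> d) (GIT_class Q \<theta> d),
      regular = (\<lambda>U. {\<phi>. \<phi> \<circ> GIT_class Q \<theta> d \<in>
         rep_regular Q d {x \<in> semistable_locus Q \<theta> d. GIT_class Q \<theta> d x \<in> U}})\<rparr>"


section \<open>Framed moduli\<close>

text \<open>The additional vertex is \<^term>\<open>None\<close>; the arrows to \<open>i\<close> are \<^term>\<open>Inr (i, k)\<close> with \<open>k < n i\<close>.\<close>

definition framed_quiver ::
  "('v, 'a) pre_digraph \<Rightarrow> ('v \<Rightarrow> nat) \<Rightarrow> ('v option, 'a + 'v \<times> nat) pre_digraph" where
  "framed_quiver Q n =
     \<lparr>verts = insert None (Some ` verts Q),
      arcs = Inl ` arcs Q \<union> Inr ` {(i, k). i \<in> verts Q \<and> k < n i},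
      tail = case_sum (\<lambda>\<alpha>. Some (tail Q \<alpha>)) (\<lambda>_. None),
      head = case_sum (\<lambda>\<alpha>. Some (head Q \<alpha>)) (\<lambda>(i, k). Some i)\<rparr>"

definition framed_dim :: "('v \<Rightarrow> nat) \<Rightarrow> 'v option \<Rightarrow> nat" where
  "framed_dim d = case_option 1 d"

definition framed_stability :: "(('v \<Rightarrow> int) \<Rightarrow> int) \<Rightarrow> ('v option \<Rightarrow> int) \<Rightarrow> int" where
  "framed_stability \<theta> e = \<theta> (\<lambda>i. e (Some i)) + e None"

definition framed_moduli_space ::
  "('v, 'a) pre_digraph \<Rightarrow> (('v \<Rightarrow> int) \<Rightarrow> int) \<Rightarrow> ('v \<Rightarrow> nat) \<Rightarrow> ('v \<Rightarrow> nat) \<Rightarrow>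
     ('a + 'v \<times> nat) rep set function_space" where
  "framed_moduli_space Q \<theta> d n =
     moduli_space (framed_quiver Q n) (framed_stability \<theta>) (framed_dim d)"

definition canonical_stability :: "('v, 'a) pre_digraph \<Rightarrow> ('v \<Rightarrow> nat) \<Rightarrow> ('v \<Rightarrow> int) \<Rightarrow> int" where
  "canonical_stability Q d = antisym_euler_form Q (\<lambda>i. int (d i))"


section \<open>The quivers of type L, C and F\<close>

datatype star_vertex = Src nat | Snk

definition quiver_L :: "nat \<Rightarrow> (star_vertex, nat) pre_digraph" where
  "quiver_L m = \<lparr>verts = insert Snk (Src ` {1..m}), arcs = {1..m},
     tail = Src, head = (\<lambda>_. Snk)\<rparr>"

definition quiver_C :: "nat \<Rightarrow> (star_vertex, nat \<times> bool) pre_digraph" where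
  "quiver_C m = \<lparr>verts = insert Snk (Src ` {1..m}), arcs = {1..m} \<times> UNIV,
     tail = (\<lambda>(k, b). Src k), head = (\<lambda>_. Snk)\<rparr>"

definition dim_star :: "nat \<Rightarrow> star_vertex \<Rightarrow> nat" where
  "dim_star d = case_star_vertex (\<lambda>k. 1) d"

datatype F_vertex = FSrc nat | FSnk1 | FSnk2

datatype F_arrow = To1 nat | To2 nat | Between nat

definition quiver_F :: "nat \<Rightarrow> nat \<Rightarrow> (F_vertex, F_arrow) pre_digraph" where
  "quiver_F n m = \<lparr>verts = FSrc ` {1..m} \<union> {FSnk1, FSnk2},
     arcs = To1 ` {1..m} \<union> To2 ` {1..m} \<union> Between ` {1..n},
     tail = case_F_arrow FSrc FSrc (\<lambda>_. FSnk1),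
     head = case_F_arrow (\<lambda>_. FSnk1) (\<lambda>_. FSnk2) (\<lambda>_. FSnk2)\<rparr>"

definition dim_F :: "nat \<Rightarrow> nat \<Rightarrow> F_vertex \<Rightarrow> nat" where
  "dim_F d1 d2 = case_F_vertex (\<lambda>k. 1) d1 d2"

definition M_L :: "nat \<Rightarrow> nat \<Rightarrow> nat rep set function_space" where
  "M_L m d = moduli_space (quiver_L m) (canonical_stability (quiver_L m) (dim_star d)) (dim_star d)"

definition M_L_fr :: "nat \<Rightarrow> nat \<Rightarrow> (nat + star_vertex \<times> nat) rep set function_space" where
  "M_L_fr m d = framed_moduli_space (quiver_L m) (canonical_stability (quiver_L m) (dim_star d))
     (dim_star d) ((\<lambda>_. 0)(Snk := 1))"

definition M_C :: "nat \<Rightarrow> nat \<Rightarrow> (nat \<times> bool) rep set function_space" where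
  "M_C m d = moduli_space (quiver_C m) (canonical_stability (quiver_C m) (dim_star d)) (dim_star d)"

definition M_C_fr ::
  "nat \<Rightarrow> nat \<Rightarrow> (nat \<times> bool + star_vertex \<times> nat) rep set function_space" where
  "M_C_fr m d = framed_moduli_space (quiver_C m) (canonical_stability (quiver_C m) (dim_star d))
     (dim_star d) ((\<lambda>_. 0)(Snk := 2))"

definition M_F :: "nat \<Rightarrow> nat \<Rightarrow> nat \<Rightarrow> nat \<Rightarrow> F_arrow rep set function_space" where
  "M_F n m d1 d2 = moduli_space (quiver_F n m)
     (canonical_stability (quiver_F n m) (dim_F d1 d2)) (dim_F d1 d2)"

definition M_F_fr ::
  "nat \<Rightarrow> nat \<Rightarrow> nat \<Rightarrow> nat \<Rightarrow> (F_arrow + F_vertex \<times> nat) rep set function_space" where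
  "M_F_fr n m d1 d2 = framed_moduli_space (quiver_F n m)
     (canonical_stability (quiver_F n m) (dim_F d1 d2))
     (dim_F d1 d2) ((\<lambda>_. 0)(FSnk1 := 1, FSnk2 := 1))"

end

theory Submission
  imports Defs
begin

text \<open>
  Framing a quiver by one arrow per sink (two, for type \<open>C\<close>) attaches the framing vertex in the same
  way as the sources are attached. So the framed quiver for \<open>m\<close> sources is the quiver for
  \<open>m + 1\<close> sources with the framing vertex as the last one, both carry the same dimension vector,
  and the two representation spaces with their group actions differ only by a relabelling of vertices
  and arrows. What has to be compared are the two stability conditions: the framed one comes from
  \<open>m\<close> sources, the other one is the canonical stability of the larger quiver.

  Call \<open>j\<close>, respectively \<open>j1\<close> and \<open>j2\<close>, the sinks, and let \<open>D\<close> be the total dimension there.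
  The divisibility assumption, or the relation \<open>m = (1 - n) d1 + d2\<close>, ensures that the
  canonical stability is \<open>c D (s - w)\<close>. Here \<open>c\<close> is 2 for type \<open>C\<close> and 1 otherwise, \<open>s\<close> is the
  total dimension at the sources, and \<open>w\<close> is an integral linear form in the dimensions at the sinks:
  \<open>w = (m / d) t\<close> for a single sink, \<open>w = (m / (d1 + d2)) (t1 + t2)\<close> for \<open>F_0\<close>, and
  \<open>w = (1 - n) t1 + t2\<close> for \<open>F_n\<close>. (If \<open>D = 0\<close>, then \<open>m = 0\<close>, the total dimension of framed
  representations is 1, and there is nothing to compare.) With \<open>e\<close> the dimension at the framing vertex
  and \<open>T\<close> the total dimension at the sinks of a subrepresentation, the canonical stability of the
  larger quiver is then \<open>c (D (s + e - w) - T)\<close>. For a nonzero proper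
  subrepresentation both semistability inequalities amount to \<open>s + e \<le> w\<close>. On the framed side, the
  slope of the whole representation is 1 over its total dimension, too small to admit a positive
  integer, so the condition is \<open>c D (s - w) + e \<le> 0\<close>, where \<open>e\<close> is 0 or 1. On the other side, the
  condition \<open>D (s + e - w) \<le> T\<close> compares a multiple of \<open>D\<close> with a number \<open>T \<le> D\<close>. The one exception
  is \<open>T = D\<close>, where both conditions hold for every proper subrepresentation. This is lemma
  \<open>framed_slope_le_iff\<close>.

  Hence relabelling identifies the semistable loci. As it also identifies the Zariski topologies,
  the regular functions and the orbits, it descends to an isomorphism of the GIT quotients
  (\<open>isomorphic_moduli_spaces\<close>).
\<close>

section \<open>Dimensions of subspaces\<close>

text \<open>
  Semistability only concerns subrepresentations that are nonzero and proper; the lemmas here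
  turn these two conditions into strict bounds on the total dimension.
\<close>

lemma subspace_basis_exists:
  assumes W: "VectorSpace.subspace class_ring W (coord_space n)"
  obtains B where "finite B" "B \<subseteq> W" "card B = subspace_dim n W" "card B \<le> n"
    "vectorspace.basis class_ring ((coord_space n)\<lparr>carrier := W\<rparr>) B"
    "\<not> module.lin_dep class_ring (coord_space n) B"
proof -
  interpret V: vec_space "TYPE(complex)" n .
  interpret W: vectorspace class_ring "V.vs W"
    using W by (rule V.subspace_is_vs)
  have sub: "submodule class_ring W V.V"
    using W by (rule V.is_module)
  have WV: "W \<subseteq> carrier V.V"
    using sub by (simp add: submodule_def)
  have li: "W.lin_dep S \<longleftrightarrow> V.lin_dep S" if "S \<subseteq> W" for S
    using V.span_li_not_depend(2)[OF that sub] .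
  have small: "finite S \<and> card S \<le> n" if "S \<subseteq> carrier (V.vs W) \<and> \<not> W.lin_dep S" for S
    using that li[of S] V.li_le_dim[of S] WV by (auto simp: V.dim_is_n)
  have "{} \<subseteq> carrier (V.vs W) \<and> \<not> W.lin_dep {}"
    by (simp add: W.lin_dep_def)
  \<comment> \<open>The size of independent sets is bounded by \<open>n\<close>, so a maximal one exists and is a basis.\<close>
  from maximal_exists[of "\<lambda>S. S \<subseteq> carrier (V.vs W) \<and> \<not> W.lin_dep S", OF small this]
  obtain B where fin: "finite B" and max: "maximal B (\<lambda>S. S \<subseteq> carrier (V.vs W) \<and> \<not> W.lin_dep S)"
    by blast
  have basis: "W.basis B"
    using max by (rule W.max_li_is_basis)
  have B: "B \<subseteq> W" "\<not> W.lin_dep B"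
    using max by (auto simp: maximal_def)
  show thesis
  proof
    show "card B = subspace_dim n W"
      unfolding subspace_dim_def using W.dim_basis[OF fin basis] by simp
    show "card B \<le> n" using small B by simp
    show "\<not> V.lin_dep B" using B li by blast
  qed (use fin B basis in auto)
qed

lemma subspace_dim_le:
  assumes "VectorSpace.subspace class_ring W (coord_space n)"
  shows "subspace_dim n W \<le> n"
  using subspace_basis_exists[OF assms] by metis

lemma subspace_dim_0:
  assumes W: "VectorSpace.subspace class_ring W (coord_space n)" and "subspace_dim n W = 0"
  shows "W = {0\<^sub>v n}"
proof -
  interpret V: vec_space "TYPE(complex)" n .
  interpret W: vectorspace class_ring "V.vs W"
    using W by (rule V.subspace_is_vs)
  obtain B where B: "finite B" "card B = 0" "W.basis B"
    using subspace_basis_exists[OF W] assms(2) by metis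
  then have "W.span {} = W"
    by (simp add: W.basis_def)
  moreover have "W.span {} = {\<zero>\<^bsub>V.vs W\<^esub>}"
    by (simp add: W.span_empty)
  ultimately show ?thesis
    by (simp add: module_vec_def)
qed

lemma subspace_dim_full:
  assumes W: "VectorSpace.subspace class_ring W (coord_space n)" and "subspace_dim n W = n"
  shows "W = carrier_vec n"
proof -
  interpret V: vec_space "TYPE(complex)" n .
  have sub: "submodule class_ring W V.V"
    using W by (rule V.is_module)
  have WV: "W \<subseteq> carrier_vec n"
    using sub by (simp add: submodule_def module_vec_def)
  obtain B where B: "finite B" "B \<subseteq> W" "card B = n" "\<not> V.lin_dep B"
    using subspace_basis_exists[OF W] assms(2) by metis
  then have "V.basis B"
    using WV by (intro V.dim_li_is_basis) (auto simp: V.dim_is_n)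
  then have "V.span B = carrier_vec n"
    by (simp add: V.basis_def)
  moreover have "V.span B \<subseteq> W"
    using V.span_is_subset[OF B(2) sub] .
  ultimately show ?thesis using WV by blast
qed


section \<open>Relabelling a quiver\<close>

lemma topspace_rep_topology: "topspace (rep_topology Q d) = rep_space Q d"
proof -
  have "rep_space Q d \<in> {{x \<in> rep_space Q d. f x \<noteq> 0} | f. f \<in> poly_fun Q d}"
    by (rule CollectI, rule exI[of _ "\<lambda>_. 1"]) (simp add: poly_fun.poly_const)
  then show ?thesis
    unfolding rep_topology_def topology_generated_by_topspace by blast
qed

lemma topspace_semistable_topology:
  "topspace (semistable_topology Q \<theta> d) = semistable_locus Q \<theta> d"
  by (auto simp: semistable_topology_def topspace_rep_topology semistable_locus_def)

lemma topspace_quotient_topology: "topspace (quotient_topology T p) = p ` topspace T"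
proof
  show "topspace (quotient_topology T p) \<subseteq> p ` topspace T"
    using openin_topspace[of "quotient_topology T p"] unfolding openin_quotient_topology by blast
  have "{x \<in> topspace T. p x \<in> p ` topspace T} = topspace T"
    by blast
  then have "openin (quotient_topology T p) (p ` topspace T)"
    by (simp add: openin_quotient_topology)
  then show "p ` topspace T \<subseteq> topspace (quotient_topology T p)"
    by (rule openin_subset)
qed

text \<open>
  Restricting to the arrows of the target quiver is what makes the result a point of its
  representation space, whose points are undefined elsewhere.
\<close>

definition relabel :: "('w, 'b) pre_digraph \<Rightarrow> ('b \<Rightarrow> 'a) \<Rightarrow> 'a rep \<Rightarrow> 'b rep" where
  "relabel Q a x = (\<lambda>\<beta>\<in>arcs Q. x (a \<beta>))"

text \<open>
  The inverse bijections are parameters so that the situation is symmetric: every inclusion proved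
  below yields the reverse one by interchanging the two quivers.
\<close>

locale quiver_iso =
  fixes Q :: "('v, 'a) pre_digraph" and Q' :: "('w, 'b) pre_digraph"
    and d :: "'v \<Rightarrow> nat" and d' :: "'w \<Rightarrow> nat"
    and v :: "'v \<Rightarrow> 'w" and v' :: "'w \<Rightarrow> 'v" and a :: "'a \<Rightarrow> 'b" and a' :: "'b \<Rightarrow> 'a"
  assumes vert: "i \<in> verts Q \<Longrightarrow> v i \<in> verts Q' \<and> v' (v i) = i \<and> d' (v i) = d i"
    and vert': "j \<in> verts Q' \<Longrightarrow> v' j \<in> verts Q \<and> v (v' j) = j"
    and arc: "\<alpha> \<in> arcs Q \<Longrightarrow> a \<alpha> \<in> arcs Q' \<and> a' (a \<alpha>) = \<alpha>"
    and arc': "\<beta> \<in> arcs Q' \<Longrightarrow> a' \<beta> \<in> arcs Q \<and> a (a' \<beta>) = \<beta>"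
    and ends: "\<alpha> \<in> arcs Q \<Longrightarrow> tail Q \<alpha> \<in> verts Q \<and> head Q \<alpha> \<in> verts Q \<and>
      tail Q' (a \<alpha>) = v (tail Q \<alpha>) \<and> head Q' (a \<alpha>) = v (head Q \<alpha>)"
begin

lemma sym: "quiver_iso Q' Q d' d v' v a' a"
proof
  fix j assume "j \<in> verts Q'"
  then show "v' j \<in> verts Q \<and> v (v' j) = j \<and> d (v' j) = d' j"
    using vert vert' by metis
next
  fix \<beta> assume "\<beta> \<in> arcs Q'"
  then show "tail Q' \<beta> \<in> verts Q' \<and> head Q' \<beta> \<in> verts Q' \<and>
      tail Q (a' \<beta>) = v' (tail Q' \<beta>) \<and> head Q (a' \<beta>) = v' (head Q' \<beta>)"
    using arc' ends vert by metis
qed (use vert arc arc' in auto)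

lemma ends':
  assumes "\<beta> \<in> arcs Q'"
  shows "d' (head Q' \<beta>) = d (head Q (a' \<beta>))" "d' (tail Q' \<beta>) = d (tail Q (a' \<beta>))"
    "head Q (a' \<beta>) = v' (head Q' \<beta>)" "tail Q (a' \<beta>) = v' (tail Q' \<beta>)"
    "head Q' \<beta> \<in> verts Q'" "tail Q' \<beta> \<in> verts Q'"
  using arc'[OF assms] ends vert by metis+

abbreviation \<Phi> :: "'a rep \<Rightarrow> 'b rep" where "\<Phi> \<equiv> relabel Q' a'"
abbreviation \<Phi>' :: "'b rep \<Rightarrow> 'a rep" where "\<Phi>' \<equiv> relabel Q a"

lemma relabel_rep_space: "x \<in> rep_space Q d \<Longrightarrow> \<Phi> x \<in> rep_space Q' d'"
  using arc' by (simp add: rep_space_def relabel_def PiE_iff ends'(1,2))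

lemma relabel_inverse: "x \<in> rep_space Q d \<Longrightarrow> \<Phi>' (\<Phi> x) = x"
  using arc by (fastforce simp: rep_space_def relabel_def PiE_iff extensional_def)

lemma relabel_image_image:
  assumes "A \<subseteq> rep_space Q d"
  shows "\<Phi>' ` \<Phi> ` A = A"
proof -
  have "(\<lambda>x. \<Phi>' (\<Phi> x)) ` A = (\<lambda>x. x) ` A"
    using assms by (intro image_cong) (auto intro: relabel_inverse)
  then show ?thesis
    by (simp add: image_image)
qed

lemma relabel_poly_fun: "f \<in> poly_fun Q' d' \<Longrightarrow> (\<lambda>x. f (\<Phi> x)) \<in> poly_fun Q d"
proof (induction rule: poly_fun.induct)
  case (poly_coord \<beta> r s)
  then show ?case
    using poly_fun.poly_coord[of "a' \<beta>" Q r d s] arc' by (simp add: relabel_def ends')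
qed (auto intro: poly_fun.intros)

lemma continuous_map_relabel: "continuous_map (rep_topology Q d) (rep_topology Q' d') \<Phi>"
  unfolding rep_topology_def[of Q']
proof (rule continuous_on_generated_topo)
  fix U assume "U \<in> {{x \<in> rep_space Q' d'. f x \<noteq> 0} |f. f \<in> poly_fun Q' d'}"
  then obtain f where f: "f \<in> poly_fun Q' d'" and U: "U = {x \<in> rep_space Q' d'. f x \<noteq> 0}"
    by blast
  have "\<Phi> -` U \<inter> topspace (rep_topology Q d) = {x \<in> rep_space Q d. f (\<Phi> x) \<noteq> 0}"
    using relabel_rep_space by (auto simp: U topspace_rep_topology)
  moreover have "{x \<in> rep_space Q d. f (\<Phi> x) \<noteq> 0} \<in>
      {{x \<in> rep_space Q d. h x \<noteq> 0} |h. h \<in> poly_fun Q d}"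
    using relabel_poly_fun[OF f] by (intro CollectI exI[of _ "\<lambda>x. f (\<Phi> x)"]) simp
  then have "openin (rep_topology Q d) {x \<in> rep_space Q d. f (\<Phi> x) \<noteq> 0}"
    unfolding rep_topology_def by (rule topology_generated_by_Basis)
  ultimately show "openin (rep_topology Q d) (\<Phi> -` U \<inter> topspace (rep_topology Q d))"
    by simp
next
  have "\<Phi> ` topspace (rep_topology Q d) \<subseteq> topspace (rep_topology Q' d')"
    using relabel_rep_space by (auto simp: topspace_rep_topology)
  then show "\<Phi> ` topspace (rep_topology Q d) \<subseteq> \<Union> {{x \<in> rep_space Q' d'. f x \<noteq> 0} |f. f \<in> poly_fun Q' d'}"
    by (simp add: rep_topology_def topology_generated_by_topspace)
qed

text \<open>
  Regularity on \<open>W\<close> does not depend on values outside \<open>W\<close>. The function \<open>\<psi>\<close> need only agree with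
  the pullback on \<open>W\<close> because the quotient maps commute with relabelling on semistable points only.
\<close>

lemma relabel_regular:
  assumes \<phi>: "\<phi> \<in> rep_regular Q' d' W'" and W: "W \<subseteq> rep_space Q d" "\<Phi> ` W \<subseteq> W'"
    and \<psi>: "\<And>x. x \<in> W \<Longrightarrow> \<psi> x = \<phi> (\<Phi> x)"
  shows "\<psi> \<in> rep_regular Q d W"
  unfolding rep_regular_def
proof (rule, rule)
  fix x assume x: "x \<in> W"
  then obtain V f g where V: "openin (subtopology (rep_topology Q' d') W') V" "\<Phi> x \<in> V"
    and fg: "f \<in> poly_fun Q' d'" "g \<in> poly_fun Q' d'" "\<forall>y\<in>V. g y \<noteq> 0 \<and> \<phi> y = f y / g y"
    using \<phi> W unfolding rep_regular_def by blast
  have top: "topspace (subtopology (rep_topology Q d) W) = W"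
    using W by (auto simp: topspace_rep_topology)
  have "continuous_map (subtopology (rep_topology Q d) W) (subtopology (rep_topology Q' d') W') \<Phi>"
    using continuous_map_relabel W
    by (auto simp: continuous_map_in_subtopology topspace_subtopology intro: continuous_map_from_subtopology)
  from openin_continuous_map_preimage[OF this V(1)]
  have "openin (subtopology (rep_topology Q d) W) {y \<in> W. \<Phi> y \<in> V}"
    unfolding top .
  moreover have "\<forall>y\<in>{y \<in> W. \<Phi> y \<in> V}. g (\<Phi> y) \<noteq> 0 \<and> \<psi> y = f (\<Phi> y) / g (\<Phi> y)"
    using fg(3) \<psi> by simp
  ultimately show "\<exists>V. openin (subtopology (rep_topology Q d) W) V \<and> x \<in> V \<and>
      (\<exists>f\<in>poly_fun Q d. \<exists>g\<in>poly_fun Q d. \<forall>y\<in>V. g y \<noteq> 0 \<and> \<psi> y = f y / g y)"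
    using relabel_poly_fun[OF fg(1)] relabel_poly_fun[OF fg(2)] x V(2)
    by (intro exI[of _ "{y \<in> W. \<Phi> y \<in> V}"] conjI bexI[of _ "\<lambda>y. f (\<Phi> y)"] bexI[of _ "\<lambda>y. g (\<Phi> y)"])
      simp_all
qed

lemma relabel_orbit_subset:
  "\<Phi> ` rep_orbit Q d x \<subseteq> rep_orbit Q' d' (\<Phi> x)"
proof -
  have "\<Phi> (base_change Q d g x) \<in> rep_orbit Q' d' (\<Phi> x)"
    if g: "g \<in> carrier (base_change_group Q d)" for g
  proof -
    define h where "h = (\<lambda>j\<in>verts Q'. g (v' j))"
    have "h \<in> carrier (base_change_group Q' d')"
      using g vert vert'
      by (force simp: h_def base_change_group_def carrier_product_group PiE_iff)
    moreover have "\<Phi> (base_change Q d g x) = base_change Q' d' h (\<Phi> x)"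
      using arc' by (auto simp: relabel_def base_change_def h_def ends' fun_eq_iff)
    ultimately show ?thesis
      by (auto simp: rep_orbit_def)
  qed
  then show ?thesis
    by (auto simp: rep_orbit_def)
qed

lemma subrep_relabel:
  assumes "subrep Q d x U"
  shows "subrep Q' d' (\<Phi> x) (U \<circ> v')"
  unfolding subrep_def
proof (intro conjI ballI)
  fix j assume "j \<in> verts Q'"
  then have "v' j \<in> verts Q" "d' j = d (v' j)"
    using vert vert' by metis+
  then show "VectorSpace.subspace class_ring ((U \<circ> v') j) (coord_space (d' j))"
    using assms by (simp add: subrep_def)
next
  fix \<beta> u assume \<beta>: "\<beta> \<in> arcs Q'" and u: "u \<in> (U \<circ> v') (tail Q' \<beta>)"
  then have "u \<in> U (tail Q (a' \<beta>))"
    by (simp add: ends'(4))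
  then have "x (a' \<beta>) *\<^sub>v u \<in> U (head Q (a' \<beta>))"
    using assms arc'[OF \<beta>] by (simp add: subrep_def)
  then show "\<Phi> x \<beta> *\<^sub>v u \<in> (U \<circ> v') (head Q' \<beta>)"
    using \<beta> by (simp add: relabel_def ends'(3))
qed

lemma sum_verts:
  assumes "\<forall>i\<in>verts Q. e' (v i) = e i"
  shows "sum e' (verts Q') = sum e (verts Q)"
proof (rule sum.reindex_bij_witness[of _ v v'])
  show "e (v' j) = e' j" if "j \<in> verts Q'" for j
    using assms vert'[OF that] by metis
qed (use vert vert' in auto)

text \<open>
  Subrepresentations correspond under relabelling with equal dimension vectors, so semistability
  transfers once the two slope inequalities are known to agree on dimension vectors of nonzero proper
  subrepresentations. The hypothesis takes two dimension vectors \<open>e\<close> and \<open>e'\<close> that correspond on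
  vertices, since values elsewhere are arbitrary.
\<close>

lemma semistable_relabel:
  assumes fin: "finite (verts Q)" and x: "x \<in> rep_space Q d" and ss: "semistable Q \<theta> d x"
    and slopes: "\<And>e e'. \<lbrakk>\<forall>i\<in>verts Q. e' (v i) = e i; \<forall>i\<in>verts Q. 0 \<le> e i \<and> e i \<le> int (d i);
        0 < sum e (verts Q); sum e (verts Q) < (\<Sum>i\<in>verts Q. int (d i));
        slope Q \<theta> e \<le> slope Q \<theta> (\<lambda>i. int (d i))\<rbrakk>
      \<Longrightarrow> slope Q' \<theta>' e' \<le> slope Q' \<theta>' (\<lambda>i. int (d' i))"
  shows "semistable Q' \<theta>' d' (\<Phi> x)"
  unfolding semistable_def
proof (intro allI impI, elim conjE bexE)
  fix U j k
  assume U: "subrep Q' d' (\<Phi> x) U" and j: "j \<in> verts Q'" "U j \<noteq> {0\<^sub>v (d' j)}"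
    and k: "k \<in> verts Q'" "U k \<noteq> carrier_vec (d' k)"
  define e where "e i = int (subspace_dim (d i) (U (v i)))" for i
  interpret S: quiver_iso Q' Q d' d v' v a' a by (rule sym)
  have sub: "subrep Q d x (U \<circ> v)"
    using S.subrep_relabel[OF U] relabel_inverse[OF x] by simp
  then have subspace: "VectorSpace.subspace class_ring (U (v i)) (coord_space (d i))"
    if "i \<in> verts Q" for i
    using that by (simp add: subrep_def)
  have e_le: "0 \<le> e i \<and> e i \<le> int (d i)" if "i \<in> verts Q" for i
    using subspace_dim_le[OF subspace[OF that]] by (simp add: e_def)
  have j': "v' j \<in> verts Q" "(U \<circ> v) (v' j) \<noteq> {0\<^sub>v (d (v' j))}"
    and k': "v' k \<in> verts Q" "(U \<circ> v) (v' k) \<noteq> carrier_vec (d (v' k))"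
    using j k S.vert by auto
  have "0 < e (v' j)"
    using subspace_dim_0[OF subspace[OF j'(1)]] j'(2) by (auto simp: e_def)
  then have pos: "0 < sum e (verts Q)"
    using e_le by (intro sum_pos2[OF fin j'(1)]) auto
  have "e (v' k) < int (d (v' k))"
    using subspace_dim_full[OF subspace[OF k'(1)]] k'(2) e_le[OF k'(1)] by (auto simp: e_def)
  then have less: "sum e (verts Q) < (\<Sum>i\<in>verts Q. int (d i))"
    using e_le k'(1) by (intro sum_strict_mono_ex1[OF fin]) auto
  have "slope Q \<theta> e \<le> slope Q \<theta> (\<lambda>i. int (d i))"
    using ss sub j' k' unfolding semistable_def e_def by (auto simp: o_def)
  then show "slope Q' \<theta>' (\<lambda>j. int (subspace_dim (d' j) (U j))) \<le> slope Q' \<theta>' (\<lambda>i. int (d' i))"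
    by (intro slopes[of _ e]) (use e_le pos less vert in \<open>auto simp: e_def\<close>)
qed

lemma semistable_locus_relabel:
  assumes fin: "finite (verts Q)"
    and slopes: "\<And>e e'. \<lbrakk>\<forall>i\<in>verts Q. e' (v i) = e i; \<forall>i\<in>verts Q. 0 \<le> e i \<and> e i \<le> int (d i);
        0 < sum e (verts Q); sum e (verts Q) < (\<Sum>i\<in>verts Q. int (d i))\<rbrakk>
      \<Longrightarrow> slope Q \<theta> e \<le> slope Q \<theta> (\<lambda>i. int (d i)) \<longleftrightarrow>
        slope Q' \<theta>' e' \<le> slope Q' \<theta>' (\<lambda>i. int (d' i))"
    and x: "x \<in> rep_space Q d"
  shows "\<Phi> x \<in> semistable_locus Q' \<theta>' d' \<longleftrightarrow> x \<in> semistable_locus Q \<theta> d"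
proof
  interpret S: quiver_iso Q' Q d' d v' v a' a by (rule sym)
  assume "\<Phi> x \<in> semistable_locus Q' \<theta>' d'"
  then have Fx: "semistable Q' \<theta>' d' (\<Phi> x)"
    by (simp add: semistable_locus_def)
  have fin': "finite (verts Q')"
    using fin finite_surj[of "verts Q" "verts Q'" v] vert' by force
  have "semistable Q \<theta> d (\<Phi>' (\<Phi> x))"
  proof (rule S.semistable_relabel[OF fin' relabel_rep_space[OF x] Fx])
    fix e' :: "'w \<Rightarrow> int" and e :: "'v \<Rightarrow> int"
    assume *: "\<forall>i\<in>verts Q'. e (v' i) = e' i" "\<forall>i\<in>verts Q'. 0 \<le> e' i \<and> e' i \<le> int (d' i)"
      "0 < sum e' (verts Q')" "sum e' (verts Q') < (\<Sum>i\<in>verts Q'. int (d' i))"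
      "slope Q' \<theta>' e' \<le> slope Q' \<theta>' (\<lambda>i. int (d' i))"
    have "\<forall>i\<in>verts Q. e' (v i) = e i"
      using *(1) vert by metis
    moreover have "\<forall>i\<in>verts Q. 0 \<le> e i \<and> e i \<le> int (d i)"
      using *(1,2) vert by metis
    moreover have "sum e' (verts Q') = sum e (verts Q)"
      "(\<Sum>i\<in>verts Q'. int (d' i)) = (\<Sum>i\<in>verts Q. int (d i))"
      using S.sum_verts[of e e'] *(1) sum_verts[of "\<lambda>i. int (d' i)"] vert by auto
    ultimately show "slope Q \<theta> e \<le> slope Q \<theta> (\<lambda>i. int (d i))"
      using slopes[of e' e] *(3-5) by simp
  qed
  then show "x \<in> semistable_locus Q \<theta> d"
    using x by (simp add: semistable_locus_def relabel_inverse)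
next
  assume "x \<in> semistable_locus Q \<theta> d"
  then have "semistable Q \<theta> d x"
    by (simp add: semistable_locus_def)
  with x have "semistable Q' \<theta>' d' (\<Phi> x)"
    by (rule semistable_relabel[OF fin]) (use slopes in blast)
  then show "\<Phi> x \<in> semistable_locus Q' \<theta>' d'"
    using x by (simp add: semistable_locus_def relabel_rep_space)
qed

end


section \<open>Relabelling moduli spaces\<close>

locale stable_quiver_iso = quiver_iso Q Q' d d' v v' a a'
  for Q :: "('v, 'a) pre_digraph" and Q' :: "('w, 'b) pre_digraph"
    and d d' v v' a a' +
  fixes \<theta> :: "('v \<Rightarrow> int) \<Rightarrow> int" and \<theta>' :: "('w \<Rightarrow> int) \<Rightarrow> int"
  assumes locus: "x \<in> rep_space Q d \<Longrightarrow>
    relabel Q' a' x \<in> semistable_locus Q' \<theta>' d' \<longleftrightarrow> x \<in> semistable_locus Q \<theta> d"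
begin

lemma stable_sym: "stable_quiver_iso Q' Q d' d v' v a' a \<theta>' \<theta>"
proof -
  interpret S: quiver_iso Q' Q d' d v' v a' a by (rule sym)
  show ?thesis
  proof unfold_locales
    fix y assume y: "y \<in> rep_space Q' d'"
    show "\<Phi>' y \<in> semistable_locus Q \<theta> d \<longleftrightarrow> y \<in> semistable_locus Q' \<theta>' d'"
      using locus[OF S.relabel_rep_space[OF y]] by (simp add: S.relabel_inverse[OF y])
  qed
qed

lemma relabel_locus: "x \<in> semistable_locus Q \<theta> d \<Longrightarrow> \<Phi> x \<in> semistable_locus Q' \<theta>' d'"
  using locus[of x] by (simp add: semistable_locus_def)

lemma continuous_map_relabel_semistable:
  "continuous_map (semistable_topology Q \<theta> d) (semistable_topology Q' \<theta>' d') \<Phi>"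
  unfolding semistable_topology_def continuous_map_in_subtopology
proof
  show "continuous_map (subtopology (rep_topology Q d) (semistable_locus Q \<theta> d)) (rep_topology Q' d') \<Phi>"
    using continuous_map_relabel by (rule continuous_map_from_subtopology)
  show "\<Phi> \<in> topspace (subtopology (rep_topology Q d) (semistable_locus Q \<theta> d)) \<rightarrow> semistable_locus Q' \<theta>' d'"
    using relabel_locus by (auto simp: topspace_subtopology)
qed

lemma relabel_closure_orbit:
  assumes "z \<in> Abstract_Topology.closure_of (semistable_topology Q \<theta> d) (rep_orbit Q d x)"
  shows "\<Phi> z \<in> Abstract_Topology.closure_of (semistable_topology Q' \<theta>' d') (rep_orbit Q' d' (\<Phi> x))"
proof -
  have "\<Phi> z \<in> Abstract_Topology.closure_of (semistable_topology Q' \<theta>' d') (\<Phi> ` rep_orbit Q d x)"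
    using continuous_map_image_closure_subset[OF continuous_map_relabel_semistable] assms by blast
  then show ?thesis
    using closure_of_mono[OF relabel_orbit_subset] by (rule subsetD[rotated])
qed

lemma relabel_GIT_class_subset:
  assumes x: "x \<in> semistable_locus Q \<theta> d"
  shows "\<Phi> ` GIT_class Q \<theta> d x \<subseteq> GIT_class Q' \<theta>' d' (\<Phi> x)"
proof -
  have "\<Phi> y \<in> GIT_class Q' \<theta>' d' (\<Phi> x)" if "y \<in> GIT_class Q \<theta> d x" for y
  proof -
    from that obtain z where y: "y \<in> semistable_locus Q \<theta> d"
      and z: "z \<in> Abstract_Topology.closure_of (semistable_topology Q \<theta> d) (rep_orbit Q d x)"
      "z \<in> Abstract_Topology.closure_of (semistable_topology Q \<theta> d) (rep_orbit Q d y)"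
      by (auto simp: GIT_class_def)
    show ?thesis
      using relabel_closure_orbit[OF z(1)] relabel_closure_orbit[OF z(2)] relabel_locus[OF y]
      by (auto simp: GIT_class_def)
  qed
  then show ?thesis by blast
qed

lemma GIT_class_subset: "GIT_class Q \<theta> d x \<subseteq> rep_space Q d"
  by (auto simp: GIT_class_def semistable_locus_def)

text \<open>
  GIT equivalence is expressed by orbits and their closures, which relabelling preserves in both
  directions. As the points of the quotient are classes, the map induced on it is the image map.
\<close>

lemma relabel_GIT_class:
  assumes x: "x \<in> semistable_locus Q \<theta> d"
  shows "GIT_class Q' \<theta>' d' (\<Phi> x) = \<Phi> ` GIT_class Q \<theta> d x"
proof
  interpret S: stable_quiver_iso Q' Q d' d v' v a' a \<theta>' \<theta> by (rule stable_sym)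
  have "\<Phi>' ` GIT_class Q' \<theta>' d' (\<Phi> x) \<subseteq> GIT_class Q \<theta> d x"
    using S.relabel_GIT_class_subset[OF relabel_locus[OF x]] relabel_inverse x
    by (simp add: semistable_locus_def)
  then have "\<Phi> ` \<Phi>' ` GIT_class Q' \<theta>' d' (\<Phi> x) \<subseteq> \<Phi> ` GIT_class Q \<theta> d x"
    by (rule image_mono)
  moreover have "\<Phi> ` \<Phi>' ` GIT_class Q' \<theta>' d' (\<Phi> x) = GIT_class Q' \<theta>' d' (\<Phi> x)"
    using S.GIT_class_subset by (rule S.relabel_image_image)
  ultimately show "GIT_class Q' \<theta>' d' (\<Phi> x) \<subseteq> \<Phi> ` GIT_class Q \<theta> d x" by simp
qed (rule relabel_GIT_class_subset[OF x])

lemma topspace_moduli_space: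
  "topspace (zariski (moduli_space Q \<theta> d)) = GIT_class Q \<theta> d ` semistable_locus Q \<theta> d"
  by (simp add: moduli_space_def topspace_quotient_topology topspace_semistable_topology)

lemma continuous_map_moduli:
  "continuous_map (zariski (moduli_space Q \<theta> d)) (zariski (moduli_space Q' \<theta>' d')) (image \<Phi>)"
  unfolding continuous_map_def
proof (intro conjI allI impI)
  interpret S: stable_quiver_iso Q' Q d' d v' v a' a \<theta>' \<theta> by (rule stable_sym)
  show "image \<Phi> \<in> topspace (zariski (moduli_space Q \<theta> d)) \<rightarrow> topspace (zariski (moduli_space Q' \<theta>' d'))"
    unfolding topspace_moduli_space S.topspace_moduli_space
    using relabel_GIT_class relabel_locus by fastforce
  fix U assume "openin (zariski (moduli_space Q' \<theta>' d')) U"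
  then have U: "openin (semistable_topology Q' \<theta>' d')
      {y \<in> semistable_locus Q' \<theta>' d'. GIT_class Q' \<theta>' d' y \<in> U}"
    by (simp add: moduli_space_def openin_quotient_topology topspace_semistable_topology)
  have "{x \<in> semistable_locus Q \<theta> d. \<Phi> ` GIT_class Q \<theta> d x \<in> U} =
      {x \<in> topspace (semistable_topology Q \<theta> d).
        \<Phi> x \<in> {y \<in> semistable_locus Q' \<theta>' d'. GIT_class Q' \<theta>' d' y \<in> U}}"
    using relabel_GIT_class relabel_locus by (auto simp: topspace_semistable_topology)
  then have "openin (semistable_topology Q \<theta> d)
      {x \<in> semistable_locus Q \<theta> d. \<Phi> ` GIT_class Q \<theta> d x \<in> U}"
    using openin_continuous_map_preimage[OF continuous_map_relabel_semistable U] by simp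
  moreover have "{x \<in> semistable_locus Q \<theta> d. GIT_class Q \<theta> d x \<in>
        {P \<in> GIT_class Q \<theta> d ` semistable_locus Q \<theta> d. \<Phi> ` P \<in> U}} =
      {x \<in> semistable_locus Q \<theta> d. \<Phi> ` GIT_class Q \<theta> d x \<in> U}"
    by blast
  ultimately show "openin (zariski (moduli_space Q \<theta> d))
      {P \<in> topspace (zariski (moduli_space Q \<theta> d)). \<Phi> ` P \<in> U}"
    unfolding topspace_moduli_space
    by (auto simp: moduli_space_def openin_quotient_topology topspace_semistable_topology)
qed

lemma relabel_image_inverse:
  assumes "P \<in> topspace (zariski (moduli_space Q \<theta> d))"
  shows "\<Phi>' ` \<Phi> ` P = P"
proof (rule relabel_image_image)
  show "P \<subseteq> rep_space Q d"
    using assms GIT_class_subset unfolding topspace_moduli_space by blast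
qed

lemma mem_regular_moduli_space:
  "\<phi> \<in> regular (moduli_space P \<eta> b) U \<longleftrightarrow>
    \<phi> \<circ> GIT_class P \<eta> b \<in> rep_regular P b {x \<in> semistable_locus P \<eta> b. GIT_class P \<eta> b x \<in> U}"
  by (simp add: moduli_space_def)

lemma regular_moduli:
  assumes "openin (zariski (moduli_space Q' \<theta>' d')) U"
  shows "\<phi> \<in> regular (moduli_space Q' \<theta>' d') U \<longleftrightarrow>
    \<phi> \<circ> image \<Phi> \<in> regular (moduli_space Q \<theta> d) {P \<in> topspace (zariski (moduli_space Q \<theta> d)). \<Phi> ` P \<in> U}"
proof -
  interpret S: stable_quiver_iso Q' Q d' d v' v a' a \<theta>' \<theta> by (rule stable_sym)
  define W where "W = {x \<in> semistable_locus Q \<theta> d. \<Phi> ` GIT_class Q \<theta> d x \<in> U}"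
  define W' where "W' = {y \<in> semistable_locus Q' \<theta>' d'. GIT_class Q' \<theta>' d' y \<in> U}"
  have pre: "{x \<in> semistable_locus Q \<theta> d. GIT_class Q \<theta> d x \<in>
      {P \<in> topspace (zariski (moduli_space Q \<theta> d)). \<Phi> ` P \<in> U}} = W"
    by (auto simp: W_def topspace_moduli_space)
  have sub: "W \<subseteq> rep_space Q d" "W' \<subseteq> rep_space Q' d'"
    by (auto simp: W_def W'_def semistable_locus_def)
  have FW: "\<Phi> ` W \<subseteq> W'"
    using relabel_GIT_class relabel_locus by (auto simp: W_def W'_def)
  have GF: "GIT_class Q' \<theta>' d' y = \<Phi> ` GIT_class Q \<theta> d (\<Phi>' y)" if "y \<in> W'" for y
    using that sub S.relabel_inverse relabel_GIT_class S.relabel_locus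
    by (metis (no_types, lifting) W'_def mem_Collect_eq subsetD)
  have FW': "\<Phi>' ` W' \<subseteq> W"
    using GF S.relabel_locus by (auto simp: W_def W'_def)
  have "\<phi> \<circ> GIT_class Q' \<theta>' d' \<in> rep_regular Q' d' W' \<longleftrightarrow>
      (\<phi> \<circ> image \<Phi>) \<circ> GIT_class Q \<theta> d \<in> rep_regular Q d W"
  proof
    assume "\<phi> \<circ> GIT_class Q' \<theta>' d' \<in> rep_regular Q' d' W'"
    then show "(\<phi> \<circ> image \<Phi>) \<circ> GIT_class Q \<theta> d \<in> rep_regular Q d W"
      by (rule relabel_regular[OF _ sub(1) FW]) (simp add: W_def relabel_GIT_class)
  next
    assume "(\<phi> \<circ> image \<Phi>) \<circ> GIT_class Q \<theta> d \<in> rep_regular Q d W"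
    then show "\<phi> \<circ> GIT_class Q' \<theta>' d' \<in> rep_regular Q' d' W'"
      by (rule S.relabel_regular[OF _ sub(2) FW']) (simp add: GF)
  qed
  then show ?thesis
    unfolding mem_regular_moduli_space pre W'_def[symmetric] .
qed

theorem isomorphic_moduli_spaces: "isomorphic_spaces (moduli_space Q \<theta> d) (moduli_space Q' \<theta>' d')"
proof -
  interpret S: stable_quiver_iso Q' Q d' d v' v a' a \<theta>' \<theta> by (rule stable_sym)
  have "homeomorphic_maps (zariski (moduli_space Q \<theta> d)) (zariski (moduli_space Q' \<theta>' d'))
      (image \<Phi>) (image \<Phi>')"
    unfolding homeomorphic_maps_def
    by (intro conjI ballI continuous_map_moduli S.continuous_map_moduli
        relabel_image_inverse S.relabel_image_inverse)
  then have "homeomorphic_map (zariski (moduli_space Q \<theta> d)) (zariski (moduli_space Q' \<theta>' d')) (image \<Phi>)"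
    by (rule homeomorphic_maps_imp_map)
  then show ?thesis
    unfolding isomorphic_spaces_def
    by (intro exI[of _ "image \<Phi>"] conjI allI impI regular_moduli)
qed

end

section \<open>Comparing slopes\<close>

text \<open>The vertex part of the Euler form is symmetric and cancels.\<close>

lemma canonical_stability_eq:
  "canonical_stability Q d e =
    (\<Sum>\<alpha>\<in>arcs Q. e (tail Q \<alpha>) * int (d (head Q \<alpha>)) - int (d (tail Q \<alpha>)) * e (head Q \<alpha>))"
proof -
  have "(\<Sum>i\<in>verts Q. int (d i) * e i) = (\<Sum>i\<in>verts Q. e i * int (d i))"
    by (simp add: mult.commute)
  then show ?thesis
    by (simp add: canonical_stability_def antisym_euler_form_def euler_form_def sum_subtractf)
qed

text \<open>
  The numerical core. Here \<open>s\<close>, \<open>e\<close>, \<open>T\<close> are the dimensions of a subrepresentation at the sources,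
  the framing vertex and the sinks, and \<open>M\<close>, \<open>1\<close>, \<open>D\<close> those of the whole representation, so that
  the right-hand sides of the inequalities are the slopes of the latter. Both inequalities say
  \<open>s + e \<le> w\<close> if \<open>T < D\<close>. If \<open>T = D\<close> and \<open>w = M\<close>, the second one only says \<open>s + e \<le> M + 1\<close>,
  but then \<open>s + e \<le> M\<close> because the subrepresentation is proper.
\<close>

lemma framed_slope_le_iff:
  fixes c D M s T w e :: int
  assumes "0 < c" "0 \<le> M" "0 \<le> e" "e \<le> 1" "0 \<le> T" "T \<le> D"
    and full: "T = D \<Longrightarrow> w = M" and zero: "D = 0 \<Longrightarrow> M = 0"
    and k: "0 < s + e + T" "s + e + T < M + 1 + D"
  shows "(of_int (c * (D * (s - w)) + e) :: rat) / of_int (s + e + T) \<le> of_int 1 / of_int (M + 1 + D)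
    \<longleftrightarrow> (of_int (c * (D * (s + e - w) - T)) :: rat) / of_int (s + e + T) \<le> of_int 0 / of_int (M + 1 + D)"
    (is "?L \<longleftrightarrow> ?R")
proof -
  define \<theta> where "\<theta> = c * (D * (s - w))"
  define k N where "k = s + e + T" and "N = M + 1 + D"
  have kN: "0 < k" "k < N" using assms by (auto simp: k_def N_def)
  \<comment> \<open>For \<open>D = 0\<close> the total dimension is 1, which leaves no room for \<open>0 < s + e + T < 1\<close>.\<close>
  have D: "0 < D"
    using assms by (cases "D = 0") auto
  have "?L \<longleftrightarrow> (of_int (\<theta> + e) :: rat) * of_int N \<le> of_int k"
    unfolding \<theta>_def[symmetric] k_def[symmetric] N_def[symmetric]
    using kN by (simp add: field_simps)
  also have "\<dots> \<longleftrightarrow> (\<theta> + e) * N \<le> k"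
    by (metis of_int_le_iff of_int_mult)
  \<comment> \<open>The slope \<open>1 / N\<close> of the whole is too small to admit a positive integer on the left.\<close>
  also have "\<dots> \<longleftrightarrow> \<theta> + e \<le> 0"
  proof
    show "\<theta> + e \<le> 0" if "(\<theta> + e) * N \<le> k"
    proof (rule ccontr)
      assume "\<not> \<theta> + e \<le> 0"
      then have "1 * N \<le> (\<theta> + e) * N"
        using kN by (intro mult_right_mono) auto
      then show False using that kN by linarith
    qed
    show "(\<theta> + e) * N \<le> k" if "\<theta> + e \<le> 0"
      using mult_nonpos_nonneg[OF that, of N] kN by linarith
  qed
  \<comment> \<open>The framing entry matters only if \<open>s = w\<close>, because \<open>\<theta>\<close> is a multiple of \<open>c * D \<ge> 1\<close>.\<close>
  also have "\<dots> \<longleftrightarrow> s + e \<le> w"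
  proof
    have cD: "0 < c * D" using D assms by simp
    have \<theta>: "\<theta> = c * D * (s - w)" by (simp add: \<theta>_def)
    show "s + e \<le> w" if "\<theta> + e \<le> 0"
    proof (rule ccontr)
      assume "\<not> s + e \<le> w"
      then consider "s - w \<ge> 1" | "s = w" "e = 1" using assms by linarith
      then show False
      proof cases
        case 1
        then have "c * D * 1 \<le> \<theta>" unfolding \<theta> using cD by (intro mult_left_mono) auto
        then show False using that cD assms by linarith
      qed (use that \<theta> in auto)
    qed
    show "\<theta> + e \<le> 0" if "s + e \<le> w"
    proof -
      have "c * D * (s - w) \<le> c * D * (- e)"
        using cD that by (intro mult_left_mono) auto
      moreover have "1 * e \<le> c * D * e"
        using cD assms by (intro mult_right_mono) auto
      ultimately show ?thesis unfolding \<theta> by simp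
    qed
  qed
  also have "\<dots> \<longleftrightarrow> D * (s + e - w) \<le> T"
  proof (cases "T = D")
    case True
    then have "s + e \<le> w"
      using full k by linarith
    moreover from this have "D * (s + e - w) \<le> 0"
      using D by (intro mult_nonneg_nonpos) auto
    ultimately show ?thesis using assms by linarith
  next
    case False
    show ?thesis
    proof
      assume "s + e \<le> w"
      then have "D * (s + e - w) \<le> 0"
        using D by (intro mult_nonneg_nonpos) auto
      then show "D * (s + e - w) \<le> T" using assms by linarith
    next
      assume *: "D * (s + e - w) \<le> T"
      show "s + e \<le> w"
      proof (rule ccontr)
        assume "\<not> s + e \<le> w"
        then have "D * 1 \<le> D * (s + e - w)"
          using D by (intro mult_left_mono) auto
        then show False using * False assms by linarith
      qed
    qed
  qed
  also have "\<dots> \<longleftrightarrow> c * (D * (s + e - w) - T) \<le> 0"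
    using assms by (simp add: mult_le_0_iff)
  also have "\<dots> \<longleftrightarrow> ?R"
    using k by (simp add: divide_le_0_iff of_int_le_0_iff[symmetric, where 'a = rat] del: of_int_mult of_int_diff of_int_le_0_iff)
  finally show ?thesis .
qed

text \<open>
  The vertices fall into sources \<open>S\<close>, all of dimension 1, and sinks \<open>R\<close>. The assumption on
  \<open>\<theta>'\<close> is what a canonical stability \<open>\<theta>\<close> becomes when one more source, the framing vertex, is
  added: up to the factor \<open>c\<close>, the new source contributes \<open>D e - T\<close>.
\<close>

theorem framed_moduli_space_isomorphic:
  fixes \<theta> :: "('v \<Rightarrow> int) \<Rightarrow> int" and \<theta>' :: "('w \<Rightarrow> int) \<Rightarrow> int"
    and c :: int and w :: "('v \<Rightarrow> int) \<Rightarrow> int"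
  assumes iso: "quiver_iso (framed_quiver Q n) Q' (framed_dim d) d' v v' a a'"
    and fin: "finite (verts Q)" and SR: "verts Q = S \<union> R" "S \<inter> R = {}"
    and S: "\<And>i. i \<in> S \<Longrightarrow> d i = 1" and c: "0 < c"
    and \<theta>: "\<And>e. \<theta> e = c * (int (\<Sum>i\<in>R. d i) * (sum e S - w e))"
    and \<theta>': "\<And>e e'. (\<And>i. i \<in> insert None (Some ` verts Q) \<Longrightarrow> e' (v i) = e i) \<Longrightarrow>
      \<theta>' e' = c * (int (\<Sum>i\<in>R. d i) * ((\<Sum>i\<in>S. e (Some i)) + e None - w (\<lambda>i. e (Some i)))
        - (\<Sum>i\<in>R. e (Some i)))"
    and w: "\<And>e. (\<And>i. i \<in> R \<Longrightarrow> e i = int (d i)) \<Longrightarrow> w e = int (card S)"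
    and S_empty: "(\<Sum>i\<in>R. d i) = 0 \<Longrightarrow> S = {}"
  shows "isomorphic_spaces (framed_moduli_space Q \<theta> d n) (moduli_space Q' \<theta>' d')"
proof -
  interpret quiver_iso "framed_quiver Q n" Q' "framed_dim d" d' v v' a a' by (rule iso)
  define D where "D = int (\<Sum>i\<in>R. d i)"
  define M where "M = int (card S)"
  have verts: "verts (framed_quiver Q n) = insert None (Some ` verts Q)"
    by (simp add: framed_quiver_def)
  have sum_e: "sum f (verts (framed_quiver Q n)) =
      (\<Sum>i\<in>S. f (Some i)) + f None + (\<Sum>i\<in>R. f (Some i))" for f :: "'v option \<Rightarrow> int"
    using fin SR by (simp add: verts sum.reindex sum.union_disjoint)
  have sum_d: "(\<Sum>i\<in>verts (framed_quiver Q n). int (framed_dim d i)) = M + 1 + D"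
    using S unfolding sum_e by (simp add: framed_dim_def M_def D_def)
  have "isomorphic_spaces (moduli_space (framed_quiver Q n) (framed_stability \<theta>) (framed_dim d))
      (moduli_space Q' \<theta>' d')"
  proof (rule stable_quiver_iso.isomorphic_moduli_spaces, unfold_locales, rule semistable_locus_relabel)
    show "finite (verts (framed_quiver Q n))"
      using fin by (simp add: verts)
  next
    fix e e'
    assume e': "\<forall>i\<in>verts (framed_quiver Q n). e' (v i) = e i"
      and e: "\<forall>i\<in>verts (framed_quiver Q n). 0 \<le> e i \<and> e i \<le> int (framed_dim d i)"
      and pos: "0 < sum e (verts (framed_quiver Q n))"
      and less: "sum e (verts (framed_quiver Q n)) < (\<Sum>i\<in>verts (framed_quiver Q n). int (framed_dim d i))"
    define s T where "s = (\<Sum>i\<in>S. e (Some i))" and "T = (\<Sum>i\<in>R. e (Some i))"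
    have e_None: "0 \<le> e None" "e None \<le> 1"
      using e by (auto simp: verts framed_dim_def)
    have e_Some: "0 \<le> e (Some i)" "e (Some i) \<le> int (d i)" if "i \<in> verts Q" for i
      using e that by (auto simp: verts framed_dim_def)
    have T: "0 \<le> T" "T \<le> D"
      unfolding T_def D_def of_nat_sum using SR by (auto intro!: sum_nonneg sum_mono e_Some)
    have w_full: "w (\<lambda>i. e (Some i)) = M" if "T = D"
      unfolding M_def
    proof (rule w)
      fix i assume i: "i \<in> R"
      have "(\<Sum>i\<in>R. e (Some i)) = (\<Sum>i\<in>R. int (d i))"
        using that by (simp add: T_def D_def)
      from sum_mono_inv[OF this _ i] show "e (Some i) = int (d i)"
        using fin e_Some SR by auto
    qed
    have M: "0 \<le> M"
      by (simp add: M_def)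
    have D_0: "M = 0" if "D = 0"
      using S_empty that unfolding M_def D_def by (metis card.empty of_nat_0 of_nat_eq_0_iff)
    have total: "0 < s + e None + T" "s + e None + T < M + 1 + D"
      using pos less unfolding sum_d unfolding sum_e s_def T_def by auto
    have "slope (framed_quiver Q n) (framed_stability \<theta>) e =
        of_int (c * (D * (s - w (\<lambda>i. e (Some i)))) + e None) / of_int (s + e None + T)"
      unfolding slope_def sum_e framed_stability_def \<theta> D_def s_def T_def ..
    moreover have "slope (framed_quiver Q n) (framed_stability \<theta>) (\<lambda>i. int (framed_dim d i)) =
        of_int 1 / of_int (M + 1 + D)"
      using w[of "\<lambda>i. int (d i)"] S
      unfolding slope_def sum_d framed_stability_def \<theta> by (simp add: framed_dim_def)
    moreover have "slope Q' \<theta>' e' =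
        of_int (c * (D * (s + e None - w (\<lambda>i. e (Some i))) - T)) / of_int (s + e None + T)"
    proof -
      have "\<theta>' e' = c * (D * (s + e None - w (\<lambda>i. e (Some i))) - T)"
        unfolding D_def s_def T_def by (rule \<theta>') (use e' verts in blast)
      then show ?thesis
        by (simp add: slope_def sum_verts[OF e'] sum_e s_def T_def)
    qed
    moreover have "slope Q' \<theta>' (\<lambda>i. int (d' i)) = of_int 0 / of_int (M + 1 + D)"
    proof -
      have "\<theta>' (\<lambda>i. int (d' i)) = 0"
        using w[of "\<lambda>i. int (d i)"] S vert
        by (subst \<theta>'[where e = "\<lambda>i. int (framed_dim d i)"]) (auto simp: verts framed_dim_def)
      then show ?thesis
        by (simp add: slope_def)
    qed
    ultimately show "slope (framed_quiver Q n) (framed_stability \<theta>) e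
        \<le> slope (framed_quiver Q n) (framed_stability \<theta>) (\<lambda>i. int (framed_dim d i)) \<longleftrightarrow>
      slope Q' \<theta>' e' \<le> slope Q' \<theta>' (\<lambda>i. int (d' i))"
      by (simp only: framed_slope_le_iff[OF c M e_None T w_full D_0 total])
  qed
  then show ?thesis
    by (simp add: framed_moduli_space_def)
qed


section \<open>The quivers of type L, C and F\<close>

lemma canonical_stability_L:
  "canonical_stability (quiver_L m) (dim_star d) e =
    int d * (\<Sum>k=1..m. e (Src k)) - int m * e Snk"
  by (simp add: canonical_stability_eq quiver_L_def dim_star_def sum_subtractf sum_distrib_left mult.commute)

lemma canonical_stability_C:
  "canonical_stability (quiver_C m) (dim_star d) e =
    2 * (int d * (\<Sum>k=1..m. e (Src k)) - int m * e Snk)"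
proof -
  have "canonical_stability (quiver_C m) (dim_star d) e =
      (\<Sum>(k, b)\<in>{1..m} \<times> (UNIV :: bool set). e (Src k) * int d - e Snk)"
    by (simp add: canonical_stability_eq quiver_C_def dim_star_def case_prod_beta)
  also have "\<dots> = (\<Sum>k=1..m. \<Sum>b\<in>(UNIV :: bool set). e (Src k) * int d - e Snk)"
    by (simp only: sum.cartesian_product)
  also have "\<dots> = 2 * (int d * (\<Sum>k=1..m. e (Src k)) - int m * e Snk)"
    by (simp add: sum_subtractf sum_distrib_left sum_distrib_right algebra_simps)
  finally show ?thesis .
qed

lemma canonical_stability_F:
  "canonical_stability (quiver_F n m) (dim_F d1 d2) e =
    int (d1 + d2) * (\<Sum>k=1..m. e (FSrc k)) - int m * (e FSnk1 + e FSnk2)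
      + int n * (e FSnk1 * int d2 - int d1 * e FSnk2)"
proof -
  have "inj_on To1 A" "inj_on To2 A" "inj_on Between A" for A
    by (auto simp: inj_on_def)
  then show ?thesis
    by (subst canonical_stability_eq, simp add: quiver_F_def)
      (subst sum.union_disjoint; (subst sum.union_disjoint)?;
        auto simp: sum.reindex dim_F_def sum_subtractf sum_distrib_left algebra_simps)
qed

lemma verts_quiver_star:
  "verts (quiver_L m) = Src ` {1..m} \<union> {Snk}" "verts (quiver_C m) = Src ` {1..m} \<union> {Snk}"
  by (auto simp: quiver_L_def quiver_C_def)

lemma sum_Src: "sum f (Src ` A) = (\<Sum>k\<in>A. f (Src k))"
  by (simp add: sum.reindex inj_on_def)

lemma sum_FSrc: "sum f (FSrc ` A) = (\<Sum>k\<in>A. f (FSrc k))"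
  by (simp add: sum.reindex inj_on_def)

lemma card_Src: "card (Src ` A) = card A" "card (FSrc ` A) = card A"
  by (simp_all add: card_image inj_on_def)

lemma M_L_fr_isomorphic:
  assumes "d dvd m"
  shows "isomorphic_spaces (M_L_fr m d) (M_L (m + 1) d)"
proof -
  obtain q where q: "m = d * q" using assms by blast
  let ?v = "case_option (Src (m + 1)) id"
  have iso: "quiver_iso (framed_quiver (quiver_L m) ((\<lambda>_. 0)(Snk := 1))) (quiver_L (m + 1))
        (framed_dim (dim_star d)) (dim_star d) ?v
        (\<lambda>i. if i = Src (m + 1) then None else Some i) (case_sum id (\<lambda>_. m + 1))
        (\<lambda>k. if k = m + 1 then Inr (Snk, 0) else Inl k)"
    by unfold_locales
      (auto simp: framed_quiver_def quiver_L_def framed_dim_def dim_star_def split: if_splits)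
  show ?thesis
    unfolding M_L_fr_def M_L_def
  proof (rule framed_moduli_space_isomorphic[OF iso _ verts_quiver_star(1), where c = 1
        and w = "\<lambda>e. int q * e Snk"])
    fix e :: "star_vertex \<Rightarrow> int"
    show "canonical_stability (quiver_L m) (dim_star d) e =
        1 * (int (sum (dim_star d) {Snk}) * (sum e (Src ` {1..m}) - int q * e Snk))"
      unfolding canonical_stability_L by (simp add: dim_star_def sum_Src q algebra_simps)
  next
    fix e :: "star_vertex option \<Rightarrow> int" and e' :: "star_vertex \<Rightarrow> int"
    assume "\<And>i. i \<in> insert None (Some ` verts (quiver_L m)) \<Longrightarrow> e' (?v i) = e i"
    from this[of None] this[of "Some Snk"] this[of "Some (Src k)" for k]
    have "e' (Src (m + 1)) = e None" "e' Snk = e (Some Snk)"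
      "(\<Sum>k=1..m. e' (Src k)) = (\<Sum>k=1..m. e (Some (Src k)))"
      by (auto simp: quiver_L_def)
    then show "canonical_stability (quiver_L (m + 1)) (dim_star d) e' =
        1 * (int (sum (dim_star d) {Snk}) *
          ((\<Sum>i\<in>Src ` {1..m}. e (Some i)) + e None - int q * e (Some Snk)) - (\<Sum>i\<in>{Snk}. e (Some i)))"
      unfolding canonical_stability_L by (simp add: dim_star_def sum_Src q algebra_simps)
  next
    show "sum (dim_star d) {Snk} = 0 \<Longrightarrow> Src ` {1..m} = {}"
      by (simp add: dim_star_def q)
  qed (auto simp: verts_quiver_star card_Src dim_star_def q)
qed

lemma M_C_fr_isomorphic:
  assumes "d dvd m"
  shows "isomorphic_spaces (M_C_fr m d) (M_C (m + 1) d)"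
proof -
  obtain q where q: "m = d * q" using assms by blast
  let ?v = "case_option (Src (m + 1)) id"
  \<comment> \<open>The two framing arrows have numbers 0 and 1, the two arrows from a source are labelled by booleans.\<close>
  have iso: "quiver_iso (framed_quiver (quiver_C m) ((\<lambda>_. 0)(Snk := 2))) (quiver_C (m + 1))
        (framed_dim (dim_star d)) (dim_star d) ?v
        (\<lambda>i. if i = Src (m + 1) then None else Some i) (case_sum id (\<lambda>(_, k). (m + 1, k = 1)))
        (\<lambda>(k, b). if k = m + 1 then Inr (Snk, of_bool b) else Inl (k, b))"
    by unfold_locales
      (auto simp: framed_quiver_def quiver_C_def framed_dim_def dim_star_def split: if_splits)
  show ?thesis
    unfolding M_C_fr_def M_C_def
  proof (rule framed_moduli_space_isomorphic[OF iso _ verts_quiver_star(2), where c = 2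
        and w = "\<lambda>e. int q * e Snk"])
    fix e :: "star_vertex \<Rightarrow> int"
    show "canonical_stability (quiver_C m) (dim_star d) e =
        2 * (int (sum (dim_star d) {Snk}) * (sum e (Src ` {1..m}) - int q * e Snk))"
      unfolding canonical_stability_C by (simp add: dim_star_def sum_Src q algebra_simps)
  next
    fix e :: "star_vertex option \<Rightarrow> int" and e' :: "star_vertex \<Rightarrow> int"
    assume "\<And>i. i \<in> insert None (Some ` verts (quiver_C m)) \<Longrightarrow> e' (?v i) = e i"
    from this[of None] this[of "Some Snk"] this[of "Some (Src k)" for k]
    have "e' (Src (m + 1)) = e None" "e' Snk = e (Some Snk)"
      "(\<Sum>k=1..m. e' (Src k)) = (\<Sum>k=1..m. e (Some (Src k)))"
      by (auto simp: quiver_C_def)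
    then show "canonical_stability (quiver_C (m + 1)) (dim_star d) e' =
        2 * (int (sum (dim_star d) {Snk}) *
          ((\<Sum>i\<in>Src ` {1..m}. e (Some i)) + e None - int q * e (Some Snk)) - (\<Sum>i\<in>{Snk}. e (Some i)))"
      unfolding canonical_stability_C by (simp add: dim_star_def sum_Src q algebra_simps)
  next
    show "sum (dim_star d) {Snk} = 0 \<Longrightarrow> Src ` {1..m} = {}"
      by (simp add: dim_star_def q)
  qed (auto simp: verts_quiver_star card_Src dim_star_def q)
qed

text \<open>
  The first assumption asks that the part of the canonical stability that depends on the sinks be
  divisible by \<open>d1 + d2\<close>; this is where the two conditions on \<open>m\<close>, for \<open>n = 0\<close> and for \<open>n > 0\<close>,
  come from.
\<close>

lemma M_F_fr_isomorphic:
  fixes w :: "int \<Rightarrow> int \<Rightarrow> int"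
  assumes w: "\<And>t1 t2. int m * (t1 + t2) - int n * (t1 * int d2 - int d1 * t2) = int (d1 + d2) * w t1 t2"
    and w_full: "w (int d1) (int d2) = int m" and m: "d1 + d2 = 0 \<Longrightarrow> m = 0"
  shows "isomorphic_spaces (M_F_fr n m d1 d2) (M_F n (m + 1) d1 d2)"
proof -
  let ?v = "case_option (FSrc (m + 1)) id"
  have iso: "quiver_iso (framed_quiver (quiver_F n m) ((\<lambda>_. 0)(FSnk1 := 1, FSnk2 := 1)))
        (quiver_F n (m + 1)) (framed_dim (dim_F d1 d2)) (dim_F d1 d2) ?v
        (\<lambda>i. if i = FSrc (m + 1) then None else Some i)
        (case_sum id (\<lambda>(i, _). if i = FSnk1 then To1 (m + 1) else To2 (m + 1)))
        (\<lambda>\<beta>. if \<beta> = To1 (m + 1) then Inr (FSnk1, 0)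
             else if \<beta> = To2 (m + 1) then Inr (FSnk2, 0) else Inl \<beta>)"
    by unfold_locales
      (auto simp: framed_quiver_def quiver_F_def framed_dim_def dim_F_def split: if_splits)
  have verts: "verts (quiver_F n m) = FSrc ` {1..m} \<union> {FSnk1, FSnk2}"
    by (simp add: quiver_F_def)
  have D: "sum (dim_F d1 d2) {FSnk1, FSnk2} = d1 + d2"
    by (simp add: dim_F_def)
  show ?thesis
    unfolding M_F_fr_def M_F_def
  proof (rule framed_moduli_space_isomorphic[OF iso _ verts, where c = 1
        and w = "\<lambda>e. w (e FSnk1) (e FSnk2)", unfolded D])
    fix e :: "F_vertex \<Rightarrow> int"
    show "canonical_stability (quiver_F n m) (dim_F d1 d2) e =
        1 * (int (d1 + d2) * (sum e (FSrc ` {1..m}) - w (e FSnk1) (e FSnk2)))"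
      using w[of "e FSnk1" "e FSnk2"] unfolding canonical_stability_F by (simp add: sum_FSrc right_diff_distrib)
  next
    fix e :: "F_vertex option \<Rightarrow> int" and e' :: "F_vertex \<Rightarrow> int"
    assume "\<And>i. i \<in> insert None (Some ` verts (quiver_F n m)) \<Longrightarrow> e' (?v i) = e i"
    from this[of None] this[of "Some FSnk1"] this[of "Some FSnk2"] this[of "Some (FSrc k)" for k]
    have "e' (FSrc (m + 1)) = e None" "e' FSnk1 = e (Some FSnk1)" "e' FSnk2 = e (Some FSnk2)"
      "(\<Sum>k=1..m. e' (FSrc k)) = (\<Sum>k=1..m. e (Some (FSrc k)))"
      by (auto simp: quiver_F_def)
    then show "canonical_stability (quiver_F n (m + 1)) (dim_F d1 d2) e' =
        1 * (int (d1 + d2) * ((\<Sum>i\<in>FSrc ` {1..m}. e (Some i)) + e None - w (e (Some FSnk1)) (e (Some FSnk2)))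
          - (\<Sum>i\<in>{FSnk1, FSnk2}. e (Some i)))"
      using w[of "e (Some FSnk1)" "e (Some FSnk2)"]
      unfolding canonical_stability_F by (simp add: sum_FSrc algebra_simps)
  qed (use w_full m in \<open>auto simp: verts card_Src dim_F_def\<close>)
qed

theorem theorem1p10:
  fixes m d d1 d2 n :: nat
  shows "(d dvd m \<longrightarrow> isomorphic_spaces (M_L_fr m d) (M_L (m + 1) d)) \<and>
         (d dvd m \<longrightarrow> isomorphic_spaces (M_C_fr m d) (M_C (m + 1) d)) \<and>
         (d1 + d2 dvd m \<longrightarrow> isomorphic_spaces (M_F_fr 0 m d1 d2) (M_F 0 (m + 1) d1 d2)) \<and>
         (n > 0 \<and> (1 - int n) * int d1 + int d2 \<ge> 0 \<longrightarrow>
            isomorphic_spaces (M_F_fr n (nat ((1 - int n) * int d1 + int d2)) d1 d2)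
              (M_F n (nat ((1 - int n) * int d1 + int d2) + 1) d1 d2))"
proof (intro conjI impI)
  assume "d1 + d2 dvd m"
  then obtain q where "m = (d1 + d2) * q" by blast
  then show "isomorphic_spaces (M_F_fr 0 m d1 d2) (M_F 0 (m + 1) d1 d2)"
    by (intro M_F_fr_isomorphic[where w = "\<lambda>t1 t2. int q * (t1 + t2)"]) (auto simp: algebra_simps)
next
  assume "n > 0 \<and> (1 - int n) * int d1 + int d2 \<ge> 0"
  then show "isomorphic_spaces (M_F_fr n (nat ((1 - int n) * int d1 + int d2)) d1 d2)
      (M_F n (nat ((1 - int n) * int d1 + int d2) + 1) d1 d2)"
    by (intro M_F_fr_isomorphic[where w = "\<lambda>t1 t2. (1 - int n) * t1 + t2"]) (auto simp: algebra_simps)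
qed (rule M_L_fr_isomorphic M_C_fr_isomorphic, assumption)+

end
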